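(* Fix $\alpha\in[0,\infty]$ and let $\varepsilon$ be a $\{0,1/\alpha\}$-valued valid E-capacity kernel for a hypothesis class $\mathcal{H}$ on $\mathcal{P}$, meaning that $\varepsilon(H\mid x)\in\{0,1/\alpha\}$ for every nonempty $H\in\mathcal{H}$ and every $x\in\mathcal{X}$. Assume that the map $P\mapsto L_P$ is $\mathcal{H}$-order-measurable. Then, for every $\ell\in\mathcal{L}$ and every $P\in H_\ell$, $$P\left(\ell(d)\in C^d_\alpha(X)\text{ for every }d\in\mathcal{D}\right)\ge 1-\alpha,$$ where it is assumed that the map $x\mapsto\sup_{d\in\mathcal{D}}\varepsilon(H_{d,\ell(d)}\mid x)$ is $\Sigma$-measurable. In particular, this holds for $\ell=L_P$.
   Context: $(\mathcal{X},\Sigma)$ is a measurable space and $\mathcal{P}$ a collection of probability measures on it; under $P$, $X$ has law $P$. A hypothesis class on a set is a collection of subsets closed under arbitrary unions (including the empty union, so it contains $\emptyset$). An E-capacity for $\mathcal{H}$ is a map $\varepsilon:\mathcal{H}\to[0,\infty]$ with $\varepsilon(\emptyset)=\infty$ and $\varepsilon(H')\le\varepsilon(H)$ whenever $H\subseteq H'$, $H,H'\in\mathcal{H}$. An E-capacity kernel is a map $\varepsilon:\mathcal{H}\times\mathcal{X}\to[0,\infty]$, written $\varepsilon(H\mid x)$, with $x\mapsto\varepsilon(H\mid x)$ $\Sigma$-measurable for every $H\in\mathcal{H}$ and $H\mapsto\varepsilon(H\mid x)$ an E-capacity for every $x$. It is valid if $\mathbb{E}^P[\varepsilon(H\mid X)]\le1$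 for every nonempty $H\in\mathcal{H}$ and every $P\in H$. Conventions: $1/0=\infty$, $1/\infty=0$, $0\cdot\infty=0$. Decision setting: $\mathcal{D}$ is a set of decisions and $\mathcal{C}$ a set of consequences equipped with a preorder $\succsim$. For each $P\in\mathcal{P}$ there is a consequence function $L_P:\mathcal{D}\to\mathcal{C}$, and $\mathcal{L}=\{L_P:P\in\mathcal{P}\}$. For $d\in\mathcal{D}$, $c\in\mathcal{C}$ and $\ell\in\mathcal{L}$ put $$H_{d,c}=\{P\in\mathcal{P}:L_P(d)\succsim c\},\qquad H_\ell=\{P'\in\mathcal{P}:L_{P'}(d)\succsim\ell(d)\text{ for every }d\in\mathcal{D}\}.$$ Define the preorder $\ell\succsim_{\mathcal{L}}\ell'$ on $\mathcal{L}$ by $\ell(d)\succsim\ell'(d)$ for every $d\in\mathcal{D}$, and let $\mathcal{H}_{\succsim_{\mathcal{L}}}$ be the smallest union-closed collection of subsets of $\mathcal{L}$ containing all $U_\ell=\{\ell'\in\mathcal{L}:\ell'\succsim_{\mathcal{L}}\ell\}$, $\ell\in\mathcal{L}$. The map $P\mapsto L_P$ is $\mathcal{H}$-order-measurable if $\{P\in\mathcal{P}:L_P\in A\}\in\mathcal{H}$ for every $A\in\mathcal{H}_{\succsim_{\mathcal{L}}}$. (Under this assumption all $H_{d,c}$ and $H_\ell$ belong to $\mathcal{H}$.) The confidence set on consequences for decision $d$ is $$C^d_\alpha(x)=\{c\in\mathcal{C}:\varepsilon(H_{d,c}\mid x)<1/\alpha\}.$$ *)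

theory Defs
  imports "HOL-Probability.Probability"
begin

definition hypothesis_class :: "'a set \<Rightarrow> 'a set set \<Rightarrow> bool" where
  "hypothesis_class S \<H> \<longleftrightarrow> \<H> \<subseteq> Pow S \<and> (\<forall>\<A>\<subseteq>\<H>. \<Union>\<A> \<in> \<H>)"

definition e_capacity :: "'a set set \<Rightarrow> ('a set \<Rightarrow> ennreal) \<Rightarrow> bool" where
  "e_capacity \<H> e \<longleftrightarrow> e {} = \<infinity> \<and> (\<forall>H\<in>\<H>. \<forall>H'\<in>\<H>. H \<subseteq> H' \<longrightarrow> e H' \<le> e H)"

definition e_capacity_kernel ::
    "'x measure \<Rightarrow> 'a set set \<Rightarrow> ('a set \<Rightarrow> 'x \<Rightarrow> ennreal) \<Rightarrow> bool" where
  "e_capacity_kernel M \<H> \<epsilon> \<longleftrightarrow>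
     (\<forall>H\<in>\<H>. \<epsilon> H \<in> borel_measurable M) \<and>
     (\<forall>x\<in>space M. e_capacity \<H> (\<lambda>H. \<epsilon> H x))"

definition valid_kernel ::
    "'x measure set set \<Rightarrow> ('x measure set \<Rightarrow> 'x \<Rightarrow> ennreal) \<Rightarrow> bool" where
  "valid_kernel \<H> \<epsilon> \<longleftrightarrow> (\<forall>H\<in>\<H>. H \<noteq> {} \<longrightarrow> (\<forall>P\<in>H. (\<integral>\<^sup>+x. \<epsilon> H x \<partial>P) \<le> 1))"

text \<open>
  Throughout, \<open>geq c c'\<close> reads ``\<open>c\<close> is at least as good as \<open>c'\<close>''; the family of consequence
  functions is the image \<open>L ` \<P>\<close>.
\<close>

definition fun_geq :: "'d set \<Rightarrow> ('c \<Rightarrow> 'c \<Rightarrow> bool) \<Rightarrow> ('d \<Rightarrow> 'c) \<Rightarrow> ('d \<Rightarrow> 'c) \<Rightarrow> bool" where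
  "fun_geq D geq l l' \<longleftrightarrow> (\<forall>d\<in>D. geq (l d) (l' d))"

definition hyp_at :: "'p set \<Rightarrow> ('c \<Rightarrow> 'c \<Rightarrow> bool) \<Rightarrow> ('p \<Rightarrow> 'd \<Rightarrow> 'c) \<Rightarrow> 'd \<Rightarrow> 'c \<Rightarrow> 'p set" where
  "hyp_at \<P> geq L d c = {P\<in>\<P>. geq (L P d) c}"

definition hyp_fun ::
    "'p set \<Rightarrow> 'd set \<Rightarrow> ('c \<Rightarrow> 'c \<Rightarrow> bool) \<Rightarrow> ('p \<Rightarrow> 'd \<Rightarrow> 'c) \<Rightarrow> ('d \<Rightarrow> 'c) \<Rightarrow> 'p set" where
  "hyp_fun \<P> D geq L l = {P\<in>\<P>. \<forall>d\<in>D. geq (L P d) (l d)}"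

text \<open>
  The hull is the intersection of all hypothesis classes on \<open>S\<close> containing the principal up-sets,
  hence the smallest one.
\<close>

definition order_class :: "'a set \<Rightarrow> ('a \<Rightarrow> 'a \<Rightarrow> bool) \<Rightarrow> 'a set set" where
  "order_class S R = hypothesis_class S hull ((\<lambda>a. {b\<in>S. R b a}) ` S)"

definition order_measurable ::
    "'p set \<Rightarrow> 'p set set \<Rightarrow> 'd set \<Rightarrow> ('c \<Rightarrow> 'c \<Rightarrow> bool) \<Rightarrow> ('p \<Rightarrow> 'd \<Rightarrow> 'c) \<Rightarrow> bool" where
  "order_measurable \<P> \<H> D geq L \<longleftrightarrow>
     (\<forall>A\<in>order_class (L ` \<P>) (fun_geq D geq). {P\<in>\<P>. L P \<in> A} \<in> \<H>)"

text \<open>In \<^typ>\<open>ennreal\<close>, \<open>1 / 0 = \<infinity>\<close> and \<open>1 / \<infinity> = 0\<close>.\<close>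

definition conf_set ::
    "'p set \<Rightarrow> 'c set \<Rightarrow> ('c \<Rightarrow> 'c \<Rightarrow> bool) \<Rightarrow> ('p \<Rightarrow> 'd \<Rightarrow> 'c) \<Rightarrow> ('p set \<Rightarrow> 'x \<Rightarrow> ennreal)
      \<Rightarrow> ennreal \<Rightarrow> 'd \<Rightarrow> 'x \<Rightarrow> 'c set" where
  "conf_set \<P> C geq L \<epsilon> \<alpha> d x = {c\<in>C. \<epsilon> (hyp_at \<P> geq L d c) x < 1 / \<alpha>}"

end

theory Submission
  imports Defs
begin

text \<open>
  By order-measurability and transitivity, \<open>H\<^sub>l\<close> and every \<open>H\<^bsub>d,l(d)\<^esub>\<close> are hypotheses, and
  \<open>H\<^sub>l \<subseteq> H\<^bsub>d,l(d)\<^esub>\<close>, so \<open>\<epsilon>(H\<^sub>l | x) = 0\<close> forces \<open>\<epsilon>(H\<^bsub>d,l(d)\<^esub> | x) = 0\<close> for all \<open>d\<close>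
  simultaneously. Hence all the confidence sets cover unless \<open>\<epsilon>(H\<^sub>l | x) = 1/\<alpha>\<close>, and Markov's
  inequality bounds the probability of that event by \<open>\<alpha>\<close>.
\<close>

text \<open>A hull has the defining property only if that property survives intersections. Here it
  does: a family inside the hull lies in every competing class \<open>T\<close>, hence so does its
  union. The competitor \<open>Pow S\<close> keeps the hull among the subsets of
  \<open>S\<close>.\<close>

lemma hypothesis_class_order_class: "hypothesis_class S (order_class S R)"
proof -
  let ?G = "(\<lambda>a. {b\<in>S. R b a}) ` S"
  have "hypothesis_class S (Pow S)"
    by (auto simp: hypothesis_class_def)
  moreover have "?G \<subseteq> Pow S"
    by auto
  ultimately have "hypothesis_class S hull ?G \<subseteq> Pow S"
    by (rule hull_minimal[rotated])
  moreover have "\<Union>\<A> \<in> hypothesis_class S hull ?G"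
    if \<A>: "\<A> \<subseteq> hypothesis_class S hull ?G" for \<A>
    unfolding hull_def
  proof clarify
    fix T assume "hypothesis_class S T" and "?G \<subseteq> T"
    moreover from this have "\<A> \<subseteq> T"
      using \<A> hull_minimal[of ?G T "hypothesis_class S"] by blast
    ultimately show "\<Union>\<A> \<in> T"
      by (simp add: hypothesis_class_def)
  qed
  ultimately show ?thesis
    unfolding order_class_def by (simp add: hypothesis_class_def[of S "_ hull _"])
qed

text \<open>\<open>U\<close> is the union of the principal up-sets of its own points:
  \<open>refl\<close> puts each point into its up-set, and \<open>up\<close> keeps each up-set
  inside \<open>U\<close>.\<close>

lemma up_set_in_order_class:
  assumes "U \<subseteq> S"
    and refl: "\<And>a. a \<in> U \<Longrightarrow> R a a"
    and up: "\<And>a b. a \<in> U \<Longrightarrow> b \<in> S \<Longrightarrow> R b a \<Longrightarrow> b \<in> U"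
  shows "U \<in> order_class S R"
proof -
  have "(\<lambda>a. {b\<in>S. R b a}) ` U \<subseteq> order_class S R"
    using hull_subset[of "(\<lambda>a. {b\<in>S. R b a}) ` S" "hypothesis_class S"] \<open>U \<subseteq> S\<close>
    unfolding order_class_def by blast
  then have "(\<Union>a\<in>U. {b\<in>S. R b a}) \<in> order_class S R"
    using hypothesis_class_order_class[of S R] unfolding hypothesis_class_def by blast
  moreover have "(\<Union>a\<in>U. {b\<in>S. R b a}) = U"
    using assms by blast
  ultimately show ?thesis by simp
qed

text \<open>The consequence functions whose value at \<open>d\<close> is at least as good as
  \<open>c\<close> form an up-set by transitivity, in general not a principal one. Its preimage
  under \<open>L\<close> is the hypothesis.\<close>

lemma hyp_at_in_hypotheses:
  assumes om: "order_measurable \<P> \<H> D geq L"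
    and "reflp_on C geq" and tr: "transp_on C geq"
    and L: "\<And>P. P \<in> \<P> \<Longrightarrow> L P \<in> D \<rightarrow>\<^sub>E C"
    and "d \<in> D" "c \<in> C"
  shows "hyp_at \<P> geq L d c \<in> \<H>"
proof -
  let ?U = "{l \<in> L ` \<P>. geq (l d) c}"
  have "?U \<in> order_class (L ` \<P>) (fun_geq D geq)"
  proof (rule up_set_in_order_class)
    show "fun_geq D geq l l" if "l \<in> ?U" for l
      using that L \<open>reflp_on C geq\<close> by (fastforce simp: fun_geq_def reflp_on_def)
    show "b \<in> ?U" if a: "a \<in> ?U" and b: "b \<in> L ` \<P>" and "fun_geq D geq b a" for a b
    proof -
      have "a d \<in> C" "b d \<in> C"
        using a b L \<open>d \<in> D\<close> by (auto dest!: L)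
      moreover have "geq (b d) (a d)" "geq (a d) c"
        using that \<open>d \<in> D\<close> by (auto simp: fun_geq_def)
      ultimately have "geq (b d) c"
        using transp_onD[OF tr] \<open>c \<in> C\<close> by blast
      then show ?thesis using b by simp
    qed
  qed auto
  then have "{P\<in>\<P>. L P \<in> ?U} \<in> \<H>"
    using om unfolding order_measurable_def by blast
  moreover have "{P\<in>\<P>. L P \<in> ?U} = hyp_at \<P> geq L d c"
    by (auto simp: hyp_at_def)
  ultimately show ?thesis by simp
qed

text \<open>This is the preimage of a principal up-set, which is a generator of the order
  class.\<close>

lemma hyp_fun_in_hypotheses:
  assumes "order_measurable \<P> \<H> D geq L" "l \<in> L ` \<P>"
  shows "hyp_fun \<P> D geq L l \<in> \<H>"
proof -
  let ?U = "{l' \<in> L ` \<P>. fun_geq D geq l' l}"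
  have "?U \<in> order_class (L ` \<P>) (fun_geq D geq)"
    using assms(2) hull_subset unfolding order_class_def by fast
  then have "{P\<in>\<P>. L P \<in> ?U} \<in> \<H>"
    using assms(1) unfolding order_measurable_def by blast
  moreover have "{P\<in>\<P>. L P \<in> ?U} = hyp_fun \<P> D geq L l"
    by (auto simp: hyp_fun_def fun_geq_def)
  ultimately show ?thesis by simp
qed

text \<open>Markov's inequality at level 1/\<alpha>, in a form that also covers \<alpha> = 0 and
  \<alpha> = \<infinity>.\<close>

lemma measure_eq_inverse_level_le:
  fixes \<alpha> :: ennreal
  assumes f: "f \<in> borel_measurable P" and le: "(\<integral>\<^sup>+x. f x \<partial>P) \<le> 1"
  shows "emeasure P {x \<in> space P. f x = 1 / \<alpha>} \<le> \<alpha>"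
proof -
  let ?B = "{x \<in> space P. f x = 1 / \<alpha>}"
  have [measurable]: "?B \<in> sets P"
    using f by measurable
  have "1 / \<alpha> * emeasure P ?B = (\<integral>\<^sup>+x. 1 / \<alpha> * indicator ?B x \<partial>P)"
    by (simp add: nn_integral_cmult_indicator)
  also have "\<dots> \<le> (\<integral>\<^sup>+x. f x \<partial>P)"
    by (rule nn_integral_mono) (auto simp: indicator_def)
  finally have le1: "1 / \<alpha> * emeasure P ?B \<le> 1"
    using le by simp
  show ?thesis
  \<comment> \<open>Cancelling \<alpha> against 1/\<alpha> fails at both extremes. For \<alpha> = 0,
    \<open>le1\<close> bounds infinity times the measure by 1, so the measure is 0; for \<alpha> =
    \<infinity> the bound is trivial.\<close>
  proof (cases "\<alpha> = 0 \<or> \<alpha> = top")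
    case True
    then show ?thesis
      using le1 by (auto simp: ennreal_top_mult top_unique split: if_splits)
  next
    case False
    then have "\<alpha> * (1 / \<alpha>) = 1"
      by (simp add: ennreal_times_divide ennreal_divide_self less_top)
    then have "emeasure P ?B = \<alpha> * (1 / \<alpha> * emeasure P ?B)"
      by (simp flip: mult.assoc)
    also have "\<dots> \<le> \<alpha>"
      using mult_left_mono[OF le1, of \<alpha>] by simp
    finally show ?thesis .
  qed
qed

theorem corollary2:
  fixes M :: "'x measure" and \<P> :: "'x measure set" and \<H> :: "'x measure set set"
    and \<epsilon> :: "'x measure set \<Rightarrow> 'x \<Rightarrow> ennreal" and \<alpha> :: ennreal
    and D :: "'d set" and C :: "'c set" and geq :: "'c \<Rightarrow> 'c \<Rightarrow> bool"
    and L :: "'x measure \<Rightarrow> 'd \<Rightarrow> 'c"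
  assumes "\<And>P. P \<in> \<P> \<Longrightarrow> prob_space P"
    and "\<And>P. P \<in> \<P> \<Longrightarrow> sets P = sets M"
    and "hypothesis_class \<P> \<H>"
    and "e_capacity_kernel M \<H> \<epsilon>"
    and "valid_kernel \<H> \<epsilon>"
    and "\<And>H x. H \<in> \<H> \<Longrightarrow> H \<noteq> {} \<Longrightarrow> x \<in> space M \<Longrightarrow> \<epsilon> H x \<in> {0, 1 / \<alpha>}"
    and "reflp_on C geq" and "transp_on C geq"
    and "\<And>P. P \<in> \<P> \<Longrightarrow> L P \<in> D \<rightarrow>\<^sub>E C"
    and "order_measurable \<P> \<H> D geq L"
  shows "(\<forall>l \<in> L ` \<P>.
            (\<lambda>x. SUP d\<in>D. \<epsilon> (hyp_at \<P> geq L d (l d)) x) \<in> borel_measurable M \<longrightarrow>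
            (\<forall>P \<in> hyp_fun \<P> D geq L l.
               ereal (measure P {x \<in> space M. \<forall>d\<in>D. l d \<in> conf_set \<P> C geq L \<epsilon> \<alpha> d x})
                 \<ge> 1 - enn2ereal \<alpha>)) \<and>
         (\<forall>P \<in> \<P>.
            (\<lambda>x. SUP d\<in>D. \<epsilon> (hyp_at \<P> geq L d (L P d)) x) \<in> borel_measurable M \<longrightarrow>
            ereal (measure P {x \<in> space M. \<forall>d\<in>D. L P d \<in> conf_set \<P> C geq L \<epsilon> \<alpha> d x})
              \<ge> 1 - enn2ereal \<alpha>)"
proof -
  note prob = assms(1) and sets_eq = assms(2) and kernel = assms(4) and valid = assms(5)
    and two_valued = assms(6) and refl = assms(7) and trans = assms(8) and L = assms(9)
    and om = assms(10)
  have coverage: "ereal (measure P {x \<in> space M. \<forall>d\<in>D. l d \<in> conf_set \<P> C geq L \<epsilon> \<alpha> d x})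
      \<ge> 1 - enn2ereal \<alpha>" (is "ereal (measure P ?E) \<ge> _")
    if l: "l \<in> L ` \<P>" and P: "P \<in> hyp_fun \<P> D geq L l"
      and sup: "(\<lambda>x. SUP d\<in>D. \<epsilon> (hyp_at \<P> geq L d (l d)) x) \<in> borel_measurable M" for l P
  proof (cases "\<alpha> = top")
    \<comment> \<open>Here 1/\<alpha> = 0, so the confidence sets are empty, but the lower bound is
      minus infinity.\<close>
    case True
    then show ?thesis by (simp add: top_ennreal.rep_eq one_ereal_def)
  next
    case False
    then obtain a where a: "0 \<le> a" "\<alpha> = ennreal a"
      by (cases \<alpha>) auto
    let ?H = "hyp_fun \<P> D geq L l" and ?Hd = "\<lambda>d. hyp_at \<P> geq L d (l d)"
    have "P \<in> \<P>"
      using P by (simp add: hyp_fun_def)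
    interpret prob_space P
      using prob[OF \<open>P \<in> \<P>\<close>] .
    have setsP: "sets P = sets M" and spaceP: "space P = space M"
      using sets_eq[OF \<open>P \<in> \<P>\<close>] sets_eq_imp_space_eq by auto
    have lC: "l d \<in> C" if "d \<in> D" for d
      using l L that by (auto dest!: L)
    have H: "?H \<in> \<H>"
      using hyp_fun_in_hypotheses[OF om l] .
    have Hd: "?Hd d \<in> \<H>" if "d \<in> D" for d
      using hyp_at_in_hypotheses[OF om refl trans L that lC[OF that]] by blast
    have sub: "?H \<subseteq> ?Hd d" if "d \<in> D" for d
      using that by (auto simp: hyp_fun_def hyp_at_def)
    have pos: "0 < 1 / \<alpha>"
      using False by (simp add: zero_less_iff_neq_zero ennreal_divide_eq_0_iff)
    have mono: "\<epsilon> (?Hd d) x \<le> \<epsilon> ?H x" if "x \<in> space M" "d \<in> D" for x d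
      using kernel that H Hd[OF that(2)] sub[OF that(2)]
      unfolding e_capacity_kernel_def e_capacity_def by blast
    \<comment> \<open>Two values are guaranteed only on nonempty hypotheses; \<open>?Hd d\<close>
      contains \<open>P\<close>. Since 1/\<alpha> > 0, lying strictly below 1/\<alpha> then means
      being 0.\<close>
    have less_iff: "\<epsilon> (?Hd d) x < 1 / \<alpha> \<longleftrightarrow> \<epsilon> (?Hd d) x = 0" if "x \<in> space M" "d \<in> D" for x d
    proof -
      have "?Hd d \<noteq> {}"
        using sub[OF that(2)] P by blast
      then show ?thesis
        using two_valued[OF Hd[OF that(2)] _ that(1)] pos by force
    qed
    have E_iff: "x \<in> ?E \<longleftrightarrow> x \<in> space M \<and> (\<forall>d\<in>D. \<epsilon> (?Hd d) x = 0)" for x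
      using lC less_iff unfolding conf_set_def by blast
    \<comment> \<open>\<open>D\<close> may be uncountable, so measurability of \<open>?E\<close>
      comes from the assumed measurability of the supremum. For empty \<open>D\<close> the supremum
      is 0, in agreement with \<open>?E\<close> being the whole space.\<close>
    then have "?E = {x \<in> space M. (SUP d\<in>D. \<epsilon> (?Hd d) x) = 0}"
      by (auto simp add: SUP_bot_conv(1)[where 'a = ennreal, unfolded bot_ennreal])
    then have E: "?E \<in> sets P"
      using sup setsP by simp
    let ?B = "{x \<in> space P. \<epsilon> ?H x = 1 / \<alpha>}"
    have meas: "\<epsilon> ?H \<in> borel_measurable P"
      using kernel H setsP measurable_cong_sets unfolding e_capacity_kernel_def by blast
    then have B: "?B \<in> sets P"
      by measurable
    \<comment> \<open>Off \<open>?E\<close> some \<open>\<epsilon> (?Hd d) x\<close> is nonzero, so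
      by \<open>mono\<close> the larger \<open>\<epsilon> ?H x\<close> is nonzero too and must equal
      1/\<alpha>.\<close>
    have "x \<in> ?B" if "x \<in> space P - ?E" for x
      using that E_iff[of x] mono[of x] two_valued[OF H _, of x] P spaceP by fastforce
    then have "prob (space P - ?E) \<le> prob ?B"
      using B by (intro finite_measure_mono) auto
    moreover have "prob ?B \<le> a"
    proof -
      have "(\<integral>\<^sup>+x. \<epsilon> ?H x \<partial>P) \<le> 1"
        using valid H P unfolding valid_kernel_def by blast
      then show ?thesis
        using measure_eq_inverse_level_le[OF meas, of \<alpha>] a by (simp add: emeasure_eq_measure)
    qed
    ultimately have "prob ?E \<ge> 1 - a"
      using prob_compl[OF E] by simp
    then show ?thesis
      using a by (simp add: enn2ereal_ennreal one_ereal_def)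
  qed
  \<comment> \<open>Reflexivity reduces the case of the function \<open>L P\<close> itself to
    \<open>coverage\<close>.\<close>
  have "P \<in> hyp_fun \<P> D geq L (L P)" if "P \<in> \<P>" for P
    using that L[OF that] refl by (auto simp: hyp_fun_def reflp_on_def)
  then show ?thesis
    using coverage by blast
qed

end
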